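(* Let $n,m\geq 3$ with $n\geq m-1$, and let $G=\mathbb{Z}_n\times\mathbb{Z}_m=\langle a,b\mid a^n=b^m=aba^{-1}b^{-1}=e\rangle$, where $a=(1,0)$ and $b=(0,1)$. Consider $\texttt{REL}(G,\{a,b\})$. (1) If $n\equiv \pm1 \pmod m$, then Player 1 has a winning strategy. (2) If $n\equiv 0\pmod m$, then Player 2 has a winning strategy.
   Context: Game $\texttt{REL}(G,S)$: $G$ is a finite group and $S$ a generating set with $e\notin S$. Two players alternate turns, Player 1 first, starting from the empty word $w_0$. On turn $n$ the current player chooses $s_n\in S\cup S^{-1}$, subject to $s_n\neq s_{n-1}^{-1}$ when $n>1$, and forms $w_n=w_{n-1}s_n$. If $w_n$ represents the same element of $G$ as some $w_k$ with $0\le k<n$, the player who formed $w_n$ wins. If a player has no legal move, that player loses. *)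

theory Defs
  imports "HOL-Algebra.Elementary_Groups" "HOL-Algebra.Generated_Groups"
    "HOL-Number_Theory.Cong"
begin

datatype player = Player1 | Player2

locale rel_game = group G for G (structure) +
  fixes S :: "'a set"
  assumes finite_group: "finite (carrier G)"
    and gens_closed: "S \<subseteq> carrier G"
    and generating: "generate G S = carrier G"
    and one_notin_gens: "\<one> \<notin> S"
begin

text \<open>
  A position of the game is the list \<open>[s\<^sub>1, \<dots>, s\<^sub>n]\<close> of the group elements chosen so far.
  It stands for the word \<open>w\<^sub>n = s\<^sub>1 \<cdots> s\<^sub>n\<close>, and the earlier words \<open>w\<^sub>k\<close> are its prefixes.
\<close>

definition letters :: "'a set"
  where "letters = S \<union> m_inv G ` S"

definition word_value :: "'a list \<Rightarrow> 'a"
  where "word_value ws = foldl (\<otimes>) \<one> ws"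

definition revisits :: "'a list \<Rightarrow> bool"
  where "revisits ws \<longleftrightarrow> (\<exists>k < length ws. word_value (take k ws) = word_value ws)"

definition to_move :: "'a list \<Rightarrow> player"
  where "to_move ws = (if even (length ws) then Player1 else Player2)"

text \<open>The first conjunct says that the game stops as soon as a player has won.\<close>

definition legal_move :: "'a list \<Rightarrow> 'a \<Rightarrow> bool"
  where "legal_move ws s \<longleftrightarrow>
    \<not> revisits ws \<and> s \<in> letters \<and> (ws \<noteq> [] \<longrightarrow> s \<noteq> inv (last ws))"

inductive play :: "'a list \<Rightarrow> bool" where
  play_start: "play []"
| play_step: "play ws \<Longrightarrow> legal_move ws s \<Longrightarrow> play (ws @ [s])"

definition finished :: "'a list \<Rightarrow> bool"
  where "finished ws \<longleftrightarrow> (\<nexists>s. legal_move ws s)"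

text \<open>
  The last word of a play that ends in a revisit was formed by the player who moved
  from \<open>butlast ws\<close>; a play that ends otherwise is lost by the player who cannot move.
\<close>

definition won_by :: "player \<Rightarrow> 'a list \<Rightarrow> bool"
  where "won_by P ws \<longleftrightarrow> finished ws \<and>
    (if revisits ws then P = to_move (butlast ws) else P \<noteq> to_move ws)"

definition follows :: "player \<Rightarrow> ('a list \<Rightarrow> 'a) \<Rightarrow> 'a list \<Rightarrow> bool"
  where "follows P \<sigma> ws \<longleftrightarrow>
    (\<forall>k < length ws. to_move (take k ws) = P \<longrightarrow> ws ! k = \<sigma> (take k ws))"

text \<open>
  A winning strategy has to supply a legal move whenever there is one, and every finished play
  that follows it has to be a win. Since \<open>G\<close> is finite, no play goes on forever, so finished plays
  are the only outcomes to consider.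
\<close>

definition winning_strategy :: "player \<Rightarrow> ('a list \<Rightarrow> 'a) \<Rightarrow> bool"
  where "winning_strategy P \<sigma> \<longleftrightarrow>
    (\<forall>ws. play ws \<and> follows P \<sigma> ws \<longrightarrow>
      (to_move ws = P \<and> \<not> finished ws \<longrightarrow> legal_move ws (\<sigma> ws)) \<and>
      (finished ws \<longrightarrow> won_by P ws))"

definition has_winning_strategy :: "player \<Rightarrow> bool"
  where "has_winning_strategy P \<longleftrightarrow> (\<exists>\<sigma>. winning_strategy P \<sigma>)"

end

definition Zmod_prod :: "nat \<Rightarrow> nat \<Rightarrow> (int \<times> int) monoid"
  where "Zmod_prod n m = integer_mod_group n \<times>\<times> integer_mod_group m"

lemma Zmod_pow1:
  assumes "n \<ge> 2" "m \<ge> 2"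
  shows "(1, 0) [^]\<^bsub>Zmod_prod n m\<^esub> (k::nat) = (int k mod int n, 0)"
    and "(0, 1) [^]\<^bsub>Zmod_prod n m\<^esub> (k::nat) = (0, int k mod int m)"
  using assms
  by (induction k)
     (auto simp: Zmod_prod_def DirProd_def integer_mod_group_def nat_pow_def mod_simps ac_simps)

lemma rel_game_Zmod_prod:
  assumes "n \<ge> 2" "m \<ge> 2"
  shows "rel_game (Zmod_prod n m) {(1, 0), (0, 1)}"
proof -
  let ?G = "Zmod_prod n m"
  interpret group ?G
    unfolding Zmod_prod_def by (intro DirProd_group) auto
  have car: "carrier ?G = {0..<int n} \<times> {0..<int m}"
    using assms by (auto simp: Zmod_prod_def DirProd_def integer_mod_group_def)
  have sub: "{(1, 0), (0, 1)} \<subseteq> carrier ?G"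
    using assms by (auto simp: car)
  have one: "\<one>\<^bsub>?G\<^esub> = (0, 0)"
    using assms by (auto simp: Zmod_prod_def DirProd_def integer_mod_group_def)
  let ?H = "generate ?G {(1, 0), (0, 1)}"
  have pow: "x [^]\<^bsub>?G\<^esub> k \<in> ?H" if "x \<in> {(1, 0), (0, 1)}" for x and k :: nat
    using that by (induction k) (auto intro: generate.intros)
  have "carrier ?G \<subseteq> ?H"
  proof
    fix x assume "x \<in> carrier ?G"
    then obtain i j where ij: "x = (int i, int j)" "i < n" "j < m"
      unfolding car by (metis SigmaE atLeastLessThan_iff nonneg_int_cases of_nat_less_iff)
    have "(1, 0) [^]\<^bsub>?G\<^esub> i \<otimes>\<^bsub>?G\<^esub> (0, 1) [^]\<^bsub>?G\<^esub> j \<in> ?H"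
      by (intro generate.eng pow) auto
    moreover have "(1, 0) [^]\<^bsub>?G\<^esub> i \<otimes>\<^bsub>?G\<^esub> (0, 1) [^]\<^bsub>?G\<^esub> j = x"
      using ij assms unfolding Zmod_pow1[OF assms]
      by (auto simp: Zmod_prod_def DirProd_def integer_mod_group_def)
    ultimately show "x \<in> ?H" by simp
  qed
  moreover have "?H \<subseteq> carrier ?G"
    using generate_incl[OF sub] .
  ultimately show ?thesis
    using sub by unfold_locales (auto simp: car one)
qed

end

theory Submission
  imports Defs
begin

text \<open>
  The winner answers every move by the mirror image \<open>\<alpha> \<leftrightarrow> \<beta>\<close>,
  \<open>\<alpha>\<^sup>-\<^sup>1 \<leftrightarrow> \<beta>\<^sup>-\<^sup>1\<close>, where \<open>\<alpha> = a\<^sup>\<plusminus>\<^sup>1\<close> and \<open>\<beta> = b\<^sup>\<plusminus>\<^sup>1\<close> with signs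
  fixed by the opponent's first move. Hence the words formed by the winner run along a diagonal
  \<open>c\<^sub>0, c\<^sub>1 = c\<^sub>0\<alpha>\<beta>, c\<^sub>2, \<dots>\<close>; if the opponent turns back from \<open>c\<^sub>k\<close>, the answer is the visited
  word \<open>c\<^bsub>k-1\<^esub>\<close>, and otherwise \<open>c\<^sub>K = e\<close> for some \<open>K\<close>, before the opponent has met any visited word.
  Player 2 takes \<open>c\<^sub>0 = e\<close> if \<open>m\<close> divides \<open>n\<close>; Player 1 opens with \<open>c\<^sub>0 = a\<close> if \<open>n \<equiv> 1\<close>, and with
  \<open>c\<^sub>0 = b\<close> if \<open>n \<equiv> -1\<close>.
\<close>

section \<open>Words, visited values and plays\<close>

context rel_game
begin

text \<open>Only proper prefixes are recorded, so a revisit is membership of the current value, and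
  a new letter adds the value of the word that it extends.\<close>

definition visited :: "'a list \<Rightarrow> 'a set"
  where "visited ws = (\<lambda>k. word_value (take k ws)) ` {..<length ws}"

lemma revisits_iff: "revisits ws \<longleftrightarrow> word_value ws \<in> visited ws"
  unfolding revisits_def visited_def image_iff by (auto simp: eq_commute)

lemma word_value_Nil [simp]: "word_value [] = \<one>"
  by (simp add: word_value_def)

lemma word_value_snoc [simp]: "word_value (ws @ [s]) = word_value ws \<otimes> s"
  by (simp add: word_value_def)

lemma visited_Nil [simp]: "visited [] = {}"
  by (simp add: visited_def)

lemma visited_snoc [simp]: "visited (ws @ [s]) = insert (word_value ws) (visited ws)"
proof -
  have "visited (ws @ [s]) = (\<lambda>k. word_value (take k (ws @ [s]))) ` insert (length ws) {..<length ws}"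
    unfolding visited_def by (simp add: lessThan_Suc)
  also have "\<dots> = insert (word_value ws) (visited ws)"
    unfolding visited_def by auto
  finally show ?thesis .
qed

lemma one_in_visited: "ws \<noteq> [] \<Longrightarrow> \<one> \<in> visited ws"
  unfolding visited_def by (rule image_eqI[of _ _ 0]) auto

lemma play_snoc: "play (ws @ [s]) \<longleftrightarrow> play ws \<and> legal_move ws s"
  by (auto elim: play.cases intro: play.intros)

lemma play_Nil [simp]: "play []"
  by (rule play.intros)

lemma to_move_snoc: "to_move (ws @ [s]) = P \<longleftrightarrow> to_move ws \<noteq> P"
  by (cases P) (auto simp: to_move_def)

lemma follows_Nil [simp]: "follows P \<sigma> []"
  by (simp add: follows_def)

lemma follows_snoc:
  "follows P \<sigma> (ws @ [s]) \<longleftrightarrow> follows P \<sigma> ws \<and> (to_move ws = P \<longrightarrow> s = \<sigma> ws)"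
  unfolding follows_def by (auto simp: less_Suc_eq nth_append)

lemma play_appendD: "play (ws @ v) \<Longrightarrow> play ws"
  by (induction v rule: rev_induct) (auto simp: play_snoc simp flip: append_assoc)

lemma follows_appendD: "follows P \<sigma> (ws @ v) \<Longrightarrow> follows P \<sigma> ws"
  by (induction v rule: rev_induct) (auto simp: follows_snoc simp flip: append_assoc)

lemma play_revisits_append: "play (ws @ v) \<Longrightarrow> revisits ws \<Longrightarrow> v = []"
  using play_appendD[of "ws @ [hd v]" "tl v"] play_snoc[of ws "hd v"]
  by (cases v) (auto simp: legal_move_def)

lemma letters_closed: "letters \<subseteq> carrier G"
  using gens_closed by (auto simp: letters_def)

text \<open>A legal answer presupposes that the opponent has not revisited. Hence a finished play
  leaves the opponent to move, either just after a revisit by \<open>P\<close> or without a legal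
  move.\<close>

lemma winning_strategyI:
  assumes "\<And>ws. play ws \<Longrightarrow> follows P \<sigma> ws \<Longrightarrow> to_move ws = P \<Longrightarrow> legal_move ws (\<sigma> ws)"
  shows "winning_strategy P \<sigma>"
  unfolding winning_strategy_def
proof (intro allI impI conjI; elim conjE)
  fix ws assume ws: "play ws" "follows P \<sigma> ws" "finished ws"
  have P: "P \<noteq> to_move ws"
    using assms[OF ws(1,2)] ws(3) by (auto simp: finished_def)
  show "won_by P ws"
  proof (cases "revisits ws")
    case True
    then have "ws \<noteq> []" by (auto simp: revisits_def)
    then obtain ws' s where ws': "ws = ws' @ [s]" by (cases ws rule: rev_cases) auto
    have "to_move ws' = P" using P to_move_snoc[of ws' s P] unfolding ws' by blast
    with True ws(3) show ?thesis by (simp add: won_by_def ws')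
  qed (use P ws in \<open>simp add: won_by_def\<close>)
qed (use assms in auto)

text \<open>The final default serves \<open>inv \<beta>\<close>, the one remaining letter.\<close>

definition reply :: "'a \<Rightarrow> 'a \<Rightarrow> 'a \<Rightarrow> 'a"
  where "reply \<alpha> \<beta> s =
    (if s = \<alpha> then \<beta> else if s = \<beta> then \<alpha> else if s = inv \<alpha> then inv \<beta> else inv \<alpha>)"

end

locale staircase = rel_game +
  fixes \<alpha> \<beta> :: 'a and c :: "nat \<Rightarrow> 'a" and K :: nat and Z :: "'a set"
  assumes letters_eq: "letters = {\<alpha>, \<beta>, inv \<alpha>, inv \<beta>}"
    and distinct_letters: "distinct [\<alpha>, \<beta>, inv \<alpha>, inv \<beta>]"
    and c_closed: "\<And>k. c k \<in> carrier G"
    and c_Suc: "\<And>k. c (Suc k) = c k \<otimes> \<alpha> \<otimes> \<beta>" "\<And>k. c (Suc k) = c k \<otimes> \<beta> \<otimes> \<alpha>"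
    and c_K: "c K = \<one>"
    and fresh: "\<And>k s. 1 \<le> k \<Longrightarrow> k < K \<Longrightarrow> s \<in> {\<alpha>, \<beta>} \<Longrightarrow>
      c k \<otimes> s \<notin> Z \<union> c ` {..k} \<union> (\<lambda>(i, s). c i \<otimes> s) ` ({1..<k} \<times> {\<alpha>, \<beta>})"
begin

section \<open>Climbing the staircase by mirrored replies\<close>

lemma steps_closed: "\<alpha> \<in> carrier G" "\<beta> \<in> carrier G"
  using letters_closed letters_eq by auto

text \<open>
  The clause \<open>c k \<otimes> last ws \<notin> visited ws\<close> says that the last corner was passed on the other side, so
  that an opponent who turns back does not revisit.
\<close>

definition climbed :: "nat \<Rightarrow> 'a list \<Rightarrow> bool"
  where "climbed k ws \<longleftrightarrow> ws \<noteq> [] \<and> word_value ws = c (Suc k) \<and> c k \<in> visited ws \<and>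
    last ws \<in> {\<alpha>, \<beta>} \<and> c k \<otimes> last ws \<notin> visited ws \<and>
    visited ws \<subseteq> Z \<union> c ` {..k} \<union> (\<lambda>(i, s). c i \<otimes> s) ` ({1..k} \<times> {\<alpha>, \<beta>})"

text \<open>The corner \<open>c K\<close> is the value of the empty word, so arriving there is
  itself a revisit.\<close>

lemma climbed_not_last:
  assumes "climbed k ws" "\<not> revisits ws" "k < K"
  shows "Suc k < K"
proof (rule ccontr)
  assume "\<not> Suc k < K"
  then have "word_value ws = \<one>"
    using assms c_K by (metis Suc_lessI climbed_def)
  then show False
    using assms one_in_visited by (auto simp: climbed_def revisits_iff)
qed

lemma reply_legal:
  assumes "s \<in> letters"
  shows "reply \<alpha> \<beta> s \<in> letters" "reply \<alpha> \<beta> s \<noteq> inv s"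
  using assms distinct_letters steps_closed by (auto simp: letters_eq reply_def)

lemma fresh_visited:
  assumes "climbed k ws" "Suc k < K" "s \<in> {\<alpha>, \<beta>}"
  shows "c (Suc k) \<otimes> s \<notin> insert (c (Suc k)) (visited ws)"
proof -
  have "visited ws \<subseteq> Z \<union> c ` {..Suc k} \<union> (\<lambda>(i, s). c i \<otimes> s) ` ({1..<Suc k} \<times> {\<alpha>, \<beta>})"
    using assms(1) unfolding climbed_def atLeastLessThanSuc_atLeastAtMost by fastforce
  then show ?thesis
    using fresh[of "Suc k" s] assms(2,3) by fastforce
qed

text \<open>From \<open>c (Suc k)\<close> the opponent either goes forward, and the mirrored letter
  completes the next diagonal step, or goes back. As the last letter \<open>u\<close> may not be
  undone, going back leads round the other side of the square to \<open>c k \<otimes> u\<close>,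
  from where \<open>inv u\<close> reaches the visited corner \<open>c k\<close>.\<close>

lemma climb_cases:
  assumes "climbed k ws" "Suc k < K" "legal_move ws s"
  obtains t where "s \<in> {\<alpha>, \<beta>}" "t \<in> {\<alpha>, \<beta>}" "reply \<alpha> \<beta> s = t" "t \<noteq> s"
      "c (Suc k) \<otimes> s \<otimes> t = c (Suc (Suc k))"
    | t u where "t \<in> {\<alpha>, \<beta>}" "u = last ws" "s = inv t" "reply \<alpha> \<beta> s = inv u"
      "c (Suc k) \<otimes> inv t = c k \<otimes> u" "c k \<otimes> u \<notin> insert (c (Suc k)) (visited ws)"
      "c (Suc k) \<otimes> inv t \<otimes> inv u = c k"
proof -
  note cl = steps_closed c_closed
  have nt: "\<alpha> \<noteq> \<one>" "\<beta> \<noteq> \<one>" "\<alpha> \<noteq> \<beta>" "\<beta> \<noteq> \<alpha>" "\<alpha> \<noteq> inv \<alpha>" "\<beta> \<noteq> inv \<beta>"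
    "\<alpha> \<noteq> inv \<beta>" "\<beta> \<noteq> inv \<alpha>" "inv \<alpha> \<noteq> inv \<beta>" "inv \<beta> \<noteq> inv \<alpha>"
    "inv \<alpha> \<noteq> \<alpha>" "inv \<beta> \<noteq> \<beta>" "inv \<alpha> \<noteq> \<beta>" "inv \<beta> \<noteq> \<alpha>"
    using distinct_letters by auto
  have s: "s \<in> letters" "s \<noteq> inv (last ws)"
    using assms by (auto simp: legal_move_def climbed_def)
  have lw: "last ws \<in> {\<alpha>, \<beta>}" "c k \<otimes> last ws \<notin> visited ws"
    using assms(1) by (auto simp: climbed_def)
  have backward: "c (Suc k) \<otimes> inv t = c k \<otimes> u" "c k \<otimes> u \<noteq> c (Suc k)"
      "c (Suc k) \<otimes> inv t \<otimes> inv u = c k"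
    if "(t, u) = (\<alpha>, \<beta>) \<or> (t, u) = (\<beta>, \<alpha>)" for t u
  proof -
    have tu: "t \<in> carrier G" "u \<in> carrier G" "t \<noteq> \<one>" "c (Suc k) = c k \<otimes> u \<otimes> t"
      using that cl nt c_Suc by auto
    then show 1: "c (Suc k) \<otimes> inv t = c k \<otimes> u"
      using cl by (simp add: m_assoc)
    show "c k \<otimes> u \<noteq> c (Suc k)"
      using tu cl l_cancel_one'[of "c k \<otimes> u" t] by simp
    show "c (Suc k) \<otimes> inv t \<otimes> inv u = c k"
      unfolding 1 using tu cl by (simp add: m_assoc)
  qed
  \<comment> \<open>Legality excludes \<open>inv (last ws)\<close>, so a backward letter inverts the
    other one of \<open>\<alpha>\<close> and \<open>\<beta>\<close>.\<close>
  consider "s = \<alpha>" | "s = \<beta>" | "s = inv \<alpha>" "last ws = \<beta>" | "s = inv \<beta>" "last ws = \<alpha>"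
    using s lw by (auto simp: letters_eq)
  then show thesis
  proof cases
    case 1
    then show ?thesis using nt by (intro that(1)[of \<beta>]) (auto simp: reply_def c_Suc(1)[of "Suc k"])
  next
    case 2
    then show ?thesis using nt by (intro that(1)[of \<alpha>]) (auto simp: reply_def c_Suc(2)[of "Suc k"])
  next
    case 3
    then show ?thesis using nt lw backward[of \<alpha> \<beta>] by (intro that(2)[of \<alpha> \<beta>]) (auto simp: reply_def)
  next
    case 4
    then show ?thesis using nt lw backward[of \<beta> \<alpha>] by (intro that(2)[of \<beta> \<alpha>]) (auto simp: reply_def)
  qed
qed

text \<open>A forward step is new by \<open>fresh_visited\<close>; a backward one lands on the side
  of the last square that was not passed.\<close>

lemma no_revisit_from_climbed:
  assumes "climbed k ws" "Suc k < K" "legal_move ws s"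
  shows "\<not> revisits (ws @ [s])"
proof -
  have ws: "word_value ws = c (Suc k)" using assms(1) by (simp add: climbed_def)
  show ?thesis
    using assms
  proof (cases rule: climb_cases)
    case (1 t)
    then show ?thesis
      using fresh_visited[OF assms(1,2) 1(1)] by (simp add: revisits_iff ws)
  next
    case (2 t u)
    then show ?thesis by (simp add: revisits_iff ws)
  qed
qed

lemma reply_climbs:
  assumes "climbed k ws" "Suc k < K" "legal_move ws s"
  shows "climbed (Suc k) (ws @ [s, reply \<alpha> \<beta> s]) \<or> revisits (ws @ [s, reply \<alpha> \<beta> s])"
proof -
  have ws: "word_value ws = c (Suc k)" "c k \<in> visited ws"
    "visited ws \<subseteq> Z \<union> c ` {..k} \<union> (\<lambda>(i, s). c i \<otimes> s) ` ({1..k} \<times> {\<alpha>, \<beta>})"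
    using assms(1) by (auto simp: climbed_def)
  have app: "ws @ [s, r] = (ws @ [s]) @ [r]" for r by simp
  show ?thesis
    using assms
  proof (cases rule: climb_cases)
    case (1 t)
    have cl: "c (Suc k) \<in> carrier G" "s \<in> carrier G" "t \<in> carrier G"
      using 1(1,2) c_closed steps_closed by auto
    \<comment> \<open>The opponent has just used the side of \<open>s\<close>; the side of
      \<open>t\<close>, now the last letter, has to be free for \<open>climbed\<close>.\<close>
    have ne: "c (Suc k) \<otimes> t \<noteq> c (Suc k) \<otimes> s"
      using cl 1(4) by simp
    have sub: "insert (c (Suc k) \<otimes> s) (insert (c (Suc k)) (visited ws))
      \<subseteq> Z \<union> c ` {..Suc k} \<union> (\<lambda>(i, s). c i \<otimes> s) ` ({1..Suc k} \<times> {\<alpha>, \<beta>})"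
    proof -
      have "(Suc k, s) \<in> {1..Suc k} \<times> {\<alpha>, \<beta>}" using 1(1) by simp
      then have "c (Suc k) \<otimes> s \<in> (\<lambda>(i, s). c i \<otimes> s) ` ({1..Suc k} \<times> {\<alpha>, \<beta>})"
        by (rule rev_image_eqI) simp
      moreover have "(\<lambda>(i, s). c i \<otimes> s) ` ({1..k} \<times> {\<alpha>, \<beta>})
          \<subseteq> (\<lambda>(i, s). c i \<otimes> s) ` ({1..Suc k} \<times> {\<alpha>, \<beta>})"
        by (rule image_mono) auto
      moreover have "c ` {..k} \<subseteq> c ` {..Suc k}" "c (Suc k) \<in> c ` {..Suc k}" by auto
      moreover have "insert p (insert q V) \<subseteq> Z \<union> A' \<union> B'"
        if "V \<subseteq> Z \<union> A \<union> B" "A \<subseteq> A'" "B \<subseteq> B'" "q \<in> A'" "p \<in> B'" for p q V A A' B B'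
        using that by blast
      ultimately show ?thesis using ws(3) by (metis (no_types, lifting))
    qed
    have "climbed (Suc k) (ws @ [s, t])"
      unfolding climbed_def app visited_snoc word_value_snoc ws(1)
      using 1(2,5) ne sub fresh_visited[OF assms(1,2) 1(2)] by simp
    then show ?thesis using 1(3) by simp
  next
    case (2 t u)
    then show ?thesis
      unfolding app revisits_iff visited_snoc word_value_snoc ws(1) using ws(2) by simp
  qed
qed

text \<open>The invariant alternates. With the opponent to move, the winner has revisited or stands
  on a corner; with the winner to move, the corner that the opponent left is kept as well, because
  the next induction step needs it to place the reply.\<close>

lemma reply_never_loses:
  assumes ws0: "revisits ws0 \<or> climbed 0 ws0" "to_move ws0 \<noteq> P" "0 < K"
    and \<sigma>: "\<And>v. to_move (ws0 @ v) = P \<Longrightarrow> \<sigma> (ws0 @ v) = reply \<alpha> \<beta> (last (ws0 @ v))"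
    and "play (ws0 @ v)" "follows P \<sigma> (ws0 @ v)"
  shows "if to_move (ws0 @ v) = P
    then legal_move (ws0 @ v) (\<sigma> (ws0 @ v)) \<and>
      (\<exists>ws s k. ws0 @ v = ws @ [s] \<and> climbed k ws \<and> Suc k < K \<and> legal_move ws s)
    else revisits (ws0 @ v) \<or> (\<exists>k<K. climbed k (ws0 @ v))"
  using assms(5,6)
proof (induction v rule: rev_induct)
  case Nil
  then show ?case using ws0 by auto
next
  case (snoc x v)
  let ?ws = "ws0 @ v"
  have pl: "play ?ws" "legal_move ?ws x" "follows P \<sigma> ?ws" "to_move ?ws = P \<Longrightarrow> x = \<sigma> ?ws"
    using snoc.prems play_snoc[of ?ws x] follows_snoc[of P \<sigma> ?ws x] by auto
  note IH = snoc.IH[OF pl(1,3)]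
  show ?case
  proof (cases "to_move ?ws = P")
    case False
    then have tm: "to_move (?ws @ [x]) = P" using to_move_snoc[of ?ws x P] by blast
    have "\<not> revisits ?ws" using pl(2) by (simp add: legal_move_def)
    then obtain k where k: "climbed k ?ws" "Suc k < K"
      using IH False climbed_not_last by auto
    have "legal_move (?ws @ [x]) (reply \<alpha> \<beta> x)"
      using no_revisit_from_climbed[OF k pl(2)] reply_legal[of x] pl(2)
      by (simp add: legal_move_def)
    then have "legal_move (?ws @ [x]) (\<sigma> (?ws @ [x]))"
      using \<sigma>[of "v @ [x]"] tm by simp
    with k pl(2) tm show ?thesis by auto
  next
    case True
    then obtain ws s k where k: "?ws = ws @ [s]" "climbed k ws" "Suc k < K" "legal_move ws s"
      using IH by auto
    have "x = reply \<alpha> \<beta> s" using pl(4) \<sigma>[of v] True k(1) by simp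
    then have eq: "ws @ [s, reply \<alpha> \<beta> s] = ?ws @ [x]" using k(1) by simp
    have "climbed (Suc k) (?ws @ [x]) \<or> revisits (?ws @ [x])"
      using reply_climbs[OF k(2-4)] unfolding eq .
    moreover have "to_move (?ws @ [x]) \<noteq> P" using True to_move_snoc[of ?ws x P] by blast
    ultimately show ?thesis
      using k(3) by auto
  qed
qed

end


section \<open>From openings to full strategies\<close>

context rel_game
begin

text \<open>The staircase depends on the opponent's first letter and is therefore chosen per
  opening. The first disjunct serves an opening in which the winner has already revisited.\<close>

definition settled :: "('a list \<Rightarrow> 'a) \<Rightarrow> 'a list \<Rightarrow> bool"
  where "settled \<sigma> ws \<longleftrightarrow> revisits ws \<or>
    (\<exists>\<alpha> \<beta> c K Z. staircase G S \<alpha> \<beta> c K Z \<and> staircase.climbed G \<alpha> \<beta> c Z 0 ws \<and>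
      0 < K \<and> (\<forall>v. \<sigma> (ws @ v) = reply \<alpha> \<beta> (last (ws @ v))))"

text \<open>The opening of \<open>L\<close> letters is inspected directly;
  \<open>reply_never_loses\<close> then takes over, with these letters as
  \<open>ws0\<close>.\<close>

lemma winning_strategy_by_replies:
  assumes early: "\<And>ws. play ws \<Longrightarrow> follows P \<sigma> ws \<Longrightarrow> length ws < L \<Longrightarrow> to_move ws = P \<Longrightarrow>
      legal_move ws (\<sigma> ws)"
    and late: "\<And>ws. play ws \<Longrightarrow> follows P \<sigma> ws \<Longrightarrow> length ws = L \<Longrightarrow> to_move ws \<noteq> P \<and> settled \<sigma> ws"
  shows "winning_strategy P \<sigma>"
proof (rule winning_strategyI)
  fix ws assume ws: "play ws" "follows P \<sigma> ws" "to_move ws = P"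
  show "legal_move ws (\<sigma> ws)"
  proof (cases "length ws < L")
    case True
    then show ?thesis using early ws by blast
  next
    case False
    define ws0 v where "ws0 = take L ws" and "v = drop L ws"
    have wv: "ws = ws0 @ v" and len: "length ws0 = L"
      using False by (simp_all add: ws0_def v_def)
    have pl: "play (ws0 @ v)" "follows P \<sigma> (ws0 @ v)"
      using ws(1,2) unfolding wv .
    note late0 = late[OF play_appendD[OF pl(1)] follows_appendD[OF pl(2)] len]
    \<comment> \<open>No play continues past a revisit, and \<open>v\<close> is nonempty because
      different players are to move at \<open>ws0\<close> and \<open>ws\<close>.\<close>
    have "\<not> revisits ws0"
      using play_revisits_append[OF pl(1)] late0 ws(3) wv by auto
    then obtain \<alpha> \<beta> c K Z where sc: "staircase G S \<alpha> \<beta> c K Z" "staircase.climbed G \<alpha> \<beta> c Z 0 ws0"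
      "0 < K" "\<forall>v. \<sigma> (ws0 @ v) = reply \<alpha> \<beta> (last (ws0 @ v))"
      using late0 unfolding settled_def by blast
    interpret staircase G S \<alpha> \<beta> c K Z by (rule sc(1))
    show ?thesis
      using reply_never_loses[of ws0 P \<sigma> v] sc(2-4) late0 pl ws(3) unfolding wv by simp
  qed
qed

end

section \<open>The torus in integer coordinates\<close>

locale torus_game =
  fixes n m :: nat
  assumes n3: "3 \<le> n" and m3: "3 \<le> m"
begin

sublocale rel_game "Zmod_prod n m" "{(1, 0), (0, 1)}"
  by (rule rel_game_Zmod_prod) (use n3 m3 in auto)

abbreviation G where "G \<equiv> Zmod_prod n m"

text \<open>Arbitrary integers serve as coordinates, so that equality of points becomes divisibility
  and signs can be multiplied in.\<close>

definition pt :: "int \<Rightarrow> int \<Rightarrow> int \<times> int"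
  where "pt x y = (x mod int n, y mod int m)"

lemma carrier_G: "carrier G = {0..<int n} \<times> {0..<int m}"
  using n3 m3 by (auto simp: Zmod_prod_def DirProd_def integer_mod_group_def)

lemma pt_closed [simp]: "pt x y \<in> carrier G"
  using n3 m3 by (auto simp: carrier_G pt_def)

lemma pt_mult [simp]: "pt x y \<otimes>\<^bsub>G\<^esub> pt x' y' = pt (x + x') (y + y')"
  using n3 m3 by (auto simp: Zmod_prod_def DirProd_def integer_mod_group_def pt_def mod_simps)

lemma one_eq_pt: "\<one>\<^bsub>G\<^esub> = pt 0 0"
  using n3 m3 by (auto simp: Zmod_prod_def DirProd_def integer_mod_group_def pt_def)

lemma pt_inv [simp]: "inv\<^bsub>G\<^esub> pt x y = pt (- x) (- y)"
  by (rule inv_equality) (auto simp: one_eq_pt)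

lemma pt_eq_iff: "pt x y = pt x' y' \<longleftrightarrow> int n dvd x - x' \<and> int m dvd y - y'"
  by (simp add: pt_def mod_eq_dvd_iff)

lemma gens_eq_pt: "(1, 0) = pt 1 0" "(0, 1) = pt 0 1"
  using n3 m3 by (auto simp: pt_def)

lemma letters_eq_pt: "letters = {pt 1 0, pt 0 1, pt (- 1) 0, pt 0 (- 1)}"
  unfolding letters_def unfolding gens_eq_pt by auto

lemma small_not_dvd:
  assumes "\<bar>e\<bar> \<in> {1, 2}"
  shows "\<not> int n dvd e" "\<not> int m dvd e"
proof -
  have "e \<noteq> 0" using assms by auto
  then show "\<not> int n dvd e" "\<not> int m dvd e"
    using assms n3 m3 dvd_imp_le_int[of e "int n"] dvd_imp_le_int[of e "int m"] by auto
qed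

lemma distinct_pt_letters: "distinct [pt 1 0, pt 0 1, pt (- 1) 0, pt 0 (- 1)]"
  using n3 m3 small_not_dvd[of 2] small_not_dvd[of "- 2"] by (auto simp: pt_eq_iff)

section \<open>Diagonals of the torus and their fresh points\<close>

lemma sign_pt_eq_iff:
  assumes "\<epsilon> \<in> {1, - 1}" "\<delta> \<in> {1, - 1}"
  shows "pt (\<epsilon> * x) (\<delta> * y) = pt (\<epsilon> * x') (\<delta> * y') \<longleftrightarrow> int n dvd x - x' \<and> int m dvd y - y'"
  using assms by (auto simp: pt_eq_iff dvd_diff_commute)

text \<open>
  Here \<open>(x, y)\<close> is \<open>c\<^sub>0\<close>, and the first reply is preceded by a move to \<open>(x + u, y + v)\<close>. For
  \<open>n \<equiv> -1\<close> and \<open>m = 3\<close> the point \<open>(0, 2)\<close>, reached with \<open>v = 1\<close>, would be available to the opponent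
  again in step \<open>n - 1\<close>; but after that first move Player 1 wins at once by reaching \<open>(0, 3) = e\<close>.
\<close>

definition base :: "int \<Rightarrow> int \<Rightarrow> nat \<Rightarrow> int \<Rightarrow> bool"
  where "base x y K v \<longleftrightarrow>
    (x = 0 \<and> y = 0 \<and> K = n \<and> int m dvd int n) \<or>
    (x = 1 \<and> y = 0 \<and> K = n - 1 \<and> int m dvd int n - 1) \<or>
    (x = 0 \<and> y = 1 \<and> K = n \<and> int m dvd int n + 1 \<and> \<not> (m = 3 \<and> v = 1))"

text \<open>Two equal points have first coordinates that differ by \<open>0\<close> or
  \<open>n\<close>. If by \<open>0\<close>, the second ones differ by 1 or 2, which \<open>m\<close>
  does not divide. If by \<open>n\<close>, their difference is -1, -2 or -3 modulo \<open>m\<close>,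
  and -3 occurs only in the situation that \<open>base\<close> excludes for
  \<open>m = 3\<close>.\<close>

lemma base_fresh:
  assumes base: "base x y K v" and k: "1 \<le> k" "k < int K"
    and s: "(sx, sy) \<in> {(1, 0), (0, 1)}" and uv: "(u, v) \<in> {(1, 0), (0, 1)}"
    and meets: "int n dvd x + k + sx - X" "int m dvd y + k + sy - Y"
  shows "0 \<le> i \<Longrightarrow> i \<le> k \<Longrightarrow> (X, Y) \<noteq> (x + i, y + i)"
    and "1 \<le> i \<Longrightarrow> i < k \<Longrightarrow> (tx, ty) \<in> {(1, 0), (0, 1)} \<Longrightarrow> (X, Y) \<noteq> (x + i + tx, y + i + ty)"
    and "(X, Y) \<noteq> (0, 0)"
    and "(X, Y) \<noteq> (x + u, y + v)"
proof -
  have sd: "\<not> int m dvd 1" "\<not> int m dvd 2" "\<not> int m dvd - 1" "\<not> int m dvd - 2"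
    using small_not_dvd(2)[of 1] small_not_dvd(2)[of 2] small_not_dvd(2)[of "- 1"]
      small_not_dvd(2)[of "- 2"] by auto
  have Kn: "int K \<le> int n" "x = 1 \<Longrightarrow> int K = int n - 1" "x = 0 \<or> x = 1"
    using base n3 by (auto simp: base_def)
  \<comment> \<open>This is applied to differences of first coordinates; \<open>k < K\<close> keeps
    them at most \<open>n\<close>.\<close>
  have wrap: "D = 0 \<or> D = int n" if "int n dvd D" "- int n < D" "D \<le> int n" for D
  proof (cases "D = 0 \<or> D = int n")
    case False
    then show ?thesis
      using that zdvd_not_zless[of D "int n"] zdvd_not_zless[of "- D" "int n"]
      by (cases "0 < D") auto
  qed
  \<comment> \<open>In each case of \<open>base\<close>, \<open>n\<close> is congruent to
    \<open>x - y\<close> modulo \<open>m\<close>, so one turn in the first coordinate shifts the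
    second by \<open>r\<close>.\<close>
  define r where "r = x - y"
  have r: "int m dvd int n - r" "r \<in> {0, 1, - 1}" "r = 1 \<longleftrightarrow> x = 1" "r = - 1 \<longleftrightarrow> y = 1" "y = 0 \<or> y = 1"
    "\<not> (r = - 1 \<and> m = 3 \<and> v = 1)"
    using base by (auto simp: base_def r_def)
  have residue: "int m dvd r + e" if "int m dvd int n + e" for e
    using dvd_diff[OF that r(1)] by (simp add: algebra_simps)
  have m_3: "m = 3" if "int m dvd 3 \<or> int m dvd - 3"
    using that m3 zdvd_imp_le[of "int m" 3] by auto
  show "(X, Y) \<noteq> (x + i, y + i)" if i: "0 \<le> i" "i \<le> k"
  proof
    assume "(X, Y) = (x + i, y + i)"
    then have D: "int n dvd k - i + sx" and E: "int m dvd k - i + sy"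
      using meets by (auto simp: algebra_simps)
    have "k - i + sx = 0 \<or> k - i + sx = int n"
      using wrap[OF D] s k Kn i by auto
    then show False
    proof
      assume "k - i + sx = 0"
      then have "k - i + sy = 1" using s i by auto
      then show False using E sd by auto
    next
      assume *: "k - i + sx = int n"
      \<comment> \<open>Here \<open>k = n - 1\<close> and \<open>i = 0\<close>, which
        \<open>K = n - 1\<close> forbids for \<open>x = 1\<close>.\<close>
      then have "k - i + sy = int n + (- 1)" "r \<noteq> 1" using s i k Kn r by auto
      then show False using E residue[of "- 1"] sd r(2) by auto
    qed
  qed
  show "(X, Y) \<noteq> (x + i + tx, y + i + ty)" if i: "1 \<le> i" "i < k" "(tx, ty) \<in> {(1, 0), (0, 1)}"
  proof
    assume "(X, Y) = (x + i + tx, y + i + ty)"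
    then have D: "int n dvd k - i + sx - tx" and E: "int m dvd k - i + sy - ty"
      using meets by (auto simp: algebra_simps)
    have "k - i + sx - tx = 0"
      using wrap[OF D] s k Kn i by auto
    \<comment> \<open>Necessarily \<open>k = i + 1\<close>, \<open>sx = 0\<close> and
      \<open>tx = 1\<close>: the points share the first coordinate and are two apart in the
      second.\<close>
    then have "k - i + sy - ty = 2" using s i by auto
    then show False using E sd by auto
  qed
  show "(X, Y) \<noteq> (0, 0)"
  proof
    assume "(X, Y) = (0, 0)"
    then have D: "int n dvd x + k + sx" and E: "int m dvd y + k + sy"
      using meets by auto
    have "x + k + sx = int n"
      using wrap[OF D] s k Kn by auto
    \<comment> \<open>Modulo \<open>m\<close> the second coordinate becomes
      \<open>r + (y - x - 1) = - 1\<close>.\<close>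
    then have "sx = 1" "sy = 0" "y + k + sy = int n + (y - x - 1)" using s k Kn by auto
    then show False using E residue[of "y - x - 1"] sd r Kn by auto
  qed
  show "(X, Y) \<noteq> (x + u, y + v)"
  proof
    assume "(X, Y) = (x + u, y + v)"
    then have D: "int n dvd k + sx - u" and E: "int m dvd k + sy - v"
      using meets by (auto simp: algebra_simps)
    have "k + sx - u = 0 \<or> k + sx - u = int n"
      using wrap[OF D] s k Kn uv by auto
    then show False
    proof
      assume "k + sx - u = 0"
      then have "k + sy - v = 2" using s k uv by auto
      then show False using E sd by auto
    next
      assume "k + sx - u = int n"
      then have *: "sx = 1" "sy = 0" "u = 0" "v = 1" "k = int n - 1" using s k(2) Kn(1) uv by auto
      then have "r \<noteq> 1" using k(2) Kn(2) r(3) by auto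
      \<comment> \<open>For \<open>r = 0\<close> this means that \<open>m\<close> divides -2; for
        \<open>r = - 1\<close> it forces \<open>m = 3\<close>, which \<open>base\<close> rules out
        when \<open>v = 1\<close>.\<close>
      moreover have "int m dvd r + (- 2)" using E * residue[of "- 2"] by simp
      ultimately show False using sd r(2,6) m_3 * by auto
    qed
  qed
qed

text \<open>The signs reflect the torus, so \<open>sign_pt_eq_iff\<close> reduces freshness to
  \<open>base_fresh\<close>. \<open>Z\<close> becomes the identity together with the opponent's
  first stop after \<open>c 0\<close>.\<close>

lemma staircase_pt:
  assumes base: "base x y K v" and uv: "(u, v) \<in> {(1, 0), (0, 1)}"
    and sign: "\<epsilon> \<in> {1, - 1}" "\<delta> \<in> {1, - 1}"
  shows "staircase G {(1, 0), (0, 1)} (pt \<epsilon> 0) (pt 0 \<delta>)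
    (\<lambda>k. pt (\<epsilon> * (x + int k)) (\<delta> * (y + int k))) K
    {pt 0 0, pt (\<epsilon> * (x + u)) (\<delta> * (y + v))}"
proof unfold_locales
  show "letters = {pt \<epsilon> 0, pt 0 \<delta>, inv\<^bsub>G\<^esub> pt \<epsilon> 0, inv\<^bsub>G\<^esub> pt 0 \<delta>}"
    using sign by (auto simp: letters_eq_pt)
  show "distinct [pt \<epsilon> 0, pt 0 \<delta>, inv\<^bsub>G\<^esub> pt \<epsilon> 0, inv\<^bsub>G\<^esub> pt 0 \<delta>]"
    using sign distinct_pt_letters by auto
  \<comment> \<open>In all cases \<open>x + K = n\<close>, while \<open>y + K\<close> is the
    multiple of \<open>m\<close> among \<open>n\<close>, \<open>n - 1\<close>, \<open>n + 1\<close>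
    that \<open>base\<close> names.\<close>
  show "pt (\<epsilon> * (x + int K)) (\<delta> * (y + int K)) = \<one>\<^bsub>G\<^esub>"
    using base n3 sign_pt_eq_iff[OF sign, of "x + int K" "y + int K" 0 0]
    by (auto simp: base_def one_eq_pt of_nat_diff add.commute)
  fix k :: nat and s
  assume k: "1 \<le> k" "k < K" and "s \<in> {pt \<epsilon> 0, pt 0 \<delta>}"
  then have "\<exists>(sx, sy) \<in> {(1, 0), (0, 1)}. s = pt (\<epsilon> * sx) (\<delta> * sy)"
    by auto
  then obtain sx sy where s: "(sx, sy) \<in> {(1, 0), (0, 1)}" "s = pt (\<epsilon> * sx) (\<delta> * sy)"
    by blast
  let ?P = "\<lambda>X Y. pt (\<epsilon> * X) (\<delta> * Y)"
  have ne: "?P (x + int k + sx) (y + int k + sy) \<noteq> ?P X Y"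
    if "(X, Y) = (0, 0) \<or> (X, Y) = (x + u, y + v) \<or> (\<exists>i\<le>k. (X, Y) = (x + int i, y + int i)) \<or>
      (\<exists>i tx ty. 1 \<le> i \<and> i < k \<and> (tx, ty) \<in> {(1, 0), (0, 1)} \<and> (X, Y) = (x + int i + tx, y + int i + ty))"
    for X Y
  proof
    assume "?P (x + int k + sx) (y + int k + sy) = ?P X Y"
    then have *: "int n dvd x + int k + sx - X" "int m dvd y + int k + sy - Y"
      unfolding sign_pt_eq_iff[OF sign] by auto
    have k': "1 \<le> int k" "int k < int K" using k by auto
    note fresh = base_fresh[OF base k' s(1) uv *]
    from that show False
    proof (elim disjE exE conjE)
      fix i assume "i \<le> k" "(X, Y) = (x + int i, y + int i)"
      then show False using fresh(1)[of "int i"] by simp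
    next
      fix i tx ty assume "1 \<le> i" "i < k" "(tx, ty) \<in> {(1, 0), (0, 1)}" "(X, Y) = (x + int i + tx, y + int i + ty)"
      then show False using fresh(2)[of "int i" tx ty] by simp
    qed (use fresh(3,4) in auto)
  qed
  have c_s: "?P (x + int k) (y + int k) \<otimes>\<^bsub>G\<^esub> s = ?P (x + int k + sx) (y + int k + sy)" for k
    by (simp add: s(2) algebra_simps)
  show "?P (x + int k) (y + int k) \<otimes>\<^bsub>G\<^esub> s \<notin> {pt 0 0, ?P (x + u) (y + v)} \<union>
      (\<lambda>k. ?P (x + int k) (y + int k)) ` {..k} \<union>
      (\<lambda>(i, s). ?P (x + int i) (y + int i) \<otimes>\<^bsub>G\<^esub> s) ` ({1..<k} \<times> {pt \<epsilon> 0, pt 0 \<delta>})"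
  proof (rule notI, elim UnE)
    assume "?P (x + int k) (y + int k) \<otimes>\<^bsub>G\<^esub> s \<in> {pt 0 0, ?P (x + u) (y + v)}"
    then show False using ne[of 0 0] ne[of "x + u" "y + v"] unfolding c_s by auto
  next
    assume "?P (x + int k) (y + int k) \<otimes>\<^bsub>G\<^esub> s \<in> (\<lambda>k. ?P (x + int k) (y + int k)) ` {..k}"
    then obtain i where "i \<le> k" "?P (x + int k + sx) (y + int k + sy) = ?P (x + int i) (y + int i)"
      unfolding c_s by auto
    then show False using ne[of "x + int i" "y + int i"] by blast
  next
    assume "?P (x + int k) (y + int k) \<otimes>\<^bsub>G\<^esub> s \<in>
      (\<lambda>(i, s). ?P (x + int i) (y + int i) \<otimes>\<^bsub>G\<^esub> s) ` ({1..<k} \<times> {pt \<epsilon> 0, pt 0 \<delta>})"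
    then obtain i t where i: "1 \<le> i" "i < k" "t \<in> {pt \<epsilon> 0, pt 0 \<delta>}"
      "?P (x + int k + sx) (y + int k + sy) = ?P (x + int i) (y + int i) \<otimes>\<^bsub>G\<^esub> t"
      unfolding c_s by (fastforce simp del: pt_mult)
    have "\<exists>(tx, ty) \<in> {(1, 0), (0, 1)}. t = pt (\<epsilon> * tx) (\<delta> * ty)"
      using i(3) by auto
    then obtain tx ty where t: "(tx, ty) \<in> {(1, 0), (0, 1)}" "t = pt (\<epsilon> * tx) (\<delta> * ty)"
      by blast
    have "?P (x + int i) (y + int i) \<otimes>\<^bsub>G\<^esub> t = ?P (x + int i + tx) (y + int i + ty)"
      by (simp add: t(2) algebra_simps)
    then show False using ne[of "x + int i + tx" "y + int i + ty"] i t(1) by auto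
  qed
qed (simp_all only: pt_closed pt_mult, simp_all add: distrib_left ac_simps)

text \<open>The letter \<open>(u, v)\<close> is the opponent's step from \<open>c 0\<close> and
  \<open>(v, u)\<close> its mirror image. In use, \<open>ws\<close> is empty for Player 2 and the
  opening letter for Player 1.\<close>

lemma start_climbed:
  assumes base: "base x y K v" and uv: "(u, v) \<in> {(1, 0), (0, 1)}"
    and sign: "\<epsilon> \<in> {1, - 1}" "\<delta> \<in> {1, - 1}"
    and ws: "word_value ws = pt (\<epsilon> * x) (\<delta> * y)" "visited ws \<subseteq> {pt 0 0}"
  shows "staircase.climbed G (pt \<epsilon> 0) (pt 0 \<delta>)
    (\<lambda>k. pt (\<epsilon> * (x + int k)) (\<delta> * (y + int k))) {pt 0 0, pt (\<epsilon> * (x + u)) (\<delta> * (y + v))}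
    0 (ws @ [pt (\<epsilon> * u) (\<delta> * v), pt (\<epsilon> * v) (\<delta> * u)])"
proof -
  let ?P = "\<lambda>X Y. pt (\<epsilon> * X) (\<delta> * Y)"
  interpret st: staircase G "{(1, 0), (0, 1)}" "pt \<epsilon> 0" "pt 0 \<delta>" "\<lambda>k. ?P (x + int k) (y + int k)" K
    "{pt 0 0, ?P (x + u) (y + v)}"
    by (rule staircase_pt[OF base uv sign])
  have app: "ws @ [s, r] = (ws @ [s]) @ [r]" for s r by simp
  have mult: "?P X Y \<otimes>\<^bsub>G\<^esub> ?P X' Y' = ?P (X + X') (Y + Y')" for X Y X' Y'
    by (simp add: distrib_left)
  have sd: "\<not> int m dvd 1" "\<not> int m dvd 2" "\<not> int m dvd - 1" "\<not> int n dvd 1" "\<not> int n dvd 2" "\<not> int n dvd - 1"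
    using small_not_dvd[of 1] small_not_dvd[of 2] small_not_dvd[of "- 1"] by auto
  \<comment> \<open>The far side of the first square is still free.\<close>
  have ne: "?P (x + v) (y + u) \<noteq> ?P 0 0" "?P (x + v) (y + u) \<noteq> ?P x y"
    "?P (x + v) (y + u) \<noteq> ?P (x + u) (y + v)"
    unfolding sign_pt_eq_iff[OF sign] using base uv sd by (auto simp: base_def)
  have xy: "visited ((ws @ [?P u v]) @ [?P v u]) \<subseteq> {?P 0 0, ?P x y, ?P (x + u) (y + v)}"
    "?P x y \<in> visited ((ws @ [?P u v]) @ [?P v u])"
    "word_value ((ws @ [?P u v]) @ [?P v u]) = ?P (x + 1) (y + 1)"
    using ws(2) uv unfolding visited_snoc word_value_snoc ws(1) mult by auto
  have last: "?P v u \<in> {pt \<epsilon> 0, pt 0 \<delta>}"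
    using uv by auto
  have fresh: "?P (x + int 0) (y + int 0) \<otimes>\<^bsub>G\<^esub> ?P v u \<notin> visited ((ws @ [?P u v]) @ [?P v u])"
    using xy(1) ne unfolding mult of_nat_0 add_0_right by blast
  show ?thesis
    unfolding st.climbed_def app last_snoc
  proof (intro conjI fresh last)
    show "visited ((ws @ [?P u v]) @ [?P v u]) \<subseteq> {pt 0 0, ?P (x + u) (y + v)} \<union>
        (\<lambda>k. ?P (x + int k) (y + int k)) ` {..0} \<union>
        (\<lambda>(i, s). ?P (x + int i) (y + int i) \<otimes>\<^bsub>G\<^esub> s) ` ({1..0} \<times> {pt \<epsilon> 0, pt 0 \<delta>})"
      using xy(1) by auto
    show "word_value ((ws @ [?P u v]) @ [?P v u]) = ?P (x + int (Suc 0)) (y + int (Suc 0))"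
      unfolding xy(3) by simp
    show "?P (x + int 0) (y + int 0) \<in> visited ((ws @ [?P u v]) @ [?P v u])"
      using xy(2) by simp
  qed simp
qed

lemma settled_start:
  assumes base: "base x y K v" and uv: "(u, v) \<in> {(1, 0), (0, 1)}"
    and sign: "\<epsilon> \<in> {1, - 1}" "\<delta> \<in> {1, - 1}"
    and ws: "word_value ws = pt (\<epsilon> * x) (\<delta> * y)" "visited ws \<subseteq> {pt 0 0}"
    and st: "s = pt (\<epsilon> * u) (\<delta> * v)" "t = pt (\<epsilon> * v) (\<delta> * u)"
    and \<sigma>: "\<And>w. \<sigma> (ws @ [s, t] @ w) = reply (pt \<epsilon> 0) (pt 0 \<delta>) (last (t # w))"
  shows "settled \<sigma> (ws @ [s, t])"
  unfolding settled_def
proof (intro disjI2 exI conjI allI)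
  show "staircase G {(1, 0), (0, 1)} (pt \<epsilon> 0) (pt 0 \<delta>)
    (\<lambda>k. pt (\<epsilon> * (x + int k)) (\<delta> * (y + int k))) K {pt 0 0, pt (\<epsilon> * (x + u)) (\<delta> * (y + v))}"
    by (rule staircase_pt[OF base uv sign])
  show "staircase.climbed G (pt \<epsilon> 0) (pt 0 \<delta>) (\<lambda>k. pt (\<epsilon> * (x + int k)) (\<delta> * (y + int k)))
      {pt 0 0, pt (\<epsilon> * (x + u)) (\<delta> * (y + v))} 0 (ws @ [s, t])"
    unfolding st by (rule start_climbed[OF base uv sign ws])
  show "0 < K" using base n3 by (auto simp: base_def)
  show "\<sigma> ((ws @ [s, t]) @ w) = reply (pt \<epsilon> 0) (pt 0 \<delta>) (last ((ws @ [s, t]) @ w))" for w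
    using \<sigma>[of w] by simp
qed

section \<open>Opening moves and the three winning strategies\<close>

lemma pt_letters_neq [simp]:
  "pt 1 0 \<noteq> pt 0 1" "pt 1 0 \<noteq> pt (- 1) 0" "pt 1 0 \<noteq> pt 0 (- 1)"
  "pt 0 1 \<noteq> pt 1 0" "pt 0 1 \<noteq> pt (- 1) 0" "pt 0 1 \<noteq> pt 0 (- 1)"
  "pt (- 1) 0 \<noteq> pt 1 0" "pt (- 1) 0 \<noteq> pt 0 1" "pt (- 1) 0 \<noteq> pt 0 (- 1)"
  "pt 0 (- 1) \<noteq> pt 1 0" "pt 0 (- 1) \<noteq> pt 0 1" "pt 0 (- 1) \<noteq> pt (- 1) 0"
  using distinct_pt_letters by auto

lemma short_words:
  "word_value [s] = \<one>\<^bsub>G\<^esub> \<otimes>\<^bsub>G\<^esub> s" "word_value [s, t] = \<one>\<^bsub>G\<^esub> \<otimes>\<^bsub>G\<^esub> s \<otimes>\<^bsub>G\<^esub> t"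
  "word_value [s, t, r] = \<one>\<^bsub>G\<^esub> \<otimes>\<^bsub>G\<^esub> s \<otimes>\<^bsub>G\<^esub> t \<otimes>\<^bsub>G\<^esub> r"
  "visited [s] = {word_value []}" "visited [s, t] = {word_value [s], word_value []}"
  "visited [s, t, r] = {word_value [s, t], word_value [s], word_value []}"
  using visited_snoc[of "[]" s] visited_snoc[of "[s]" t] visited_snoc[of "[s, t]" r]
  by (simp_all add: word_value_def)

lemma short_plays:
  "play [s] \<longleftrightarrow> legal_move [] s" "play [s, t] \<longleftrightarrow> legal_move [] s \<and> legal_move [s] t"
  "play [s, t, r] \<longleftrightarrow> legal_move [] s \<and> legal_move [s] t \<and> legal_move [s, t] r"
  using play_snoc[of "[]" s] play_snoc[of "[s]" t] play_snoc[of "[s, t]" r] by auto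

lemma follows_short:
  "follows Player2 \<sigma> [s, t] \<Longrightarrow> t = \<sigma> [s]"
  "follows Player1 \<sigma> [s, t] \<Longrightarrow> s = \<sigma> []"
  "follows Player1 \<sigma> [s, t, r] \<Longrightarrow> s = \<sigma> [] \<and> r = \<sigma> [s, t]"
  using follows_snoc[of Player2 \<sigma> "[s]" t] follows_snoc[of Player1 \<sigma> "[s]" t]
    follows_snoc[of Player1 \<sigma> "[s, t]" r] follows_snoc[of Player1 \<sigma> "[]" s]
  by (auto simp: to_move_def)

lemma legal_move_letters: "legal_move ws s \<Longrightarrow> s \<in> {pt 1 0, pt 0 1, pt (- 1) 0, pt 0 (- 1)}"
  by (simp add: legal_move_def letters_eq_pt)

text \<open>No letter is trivial, and two letters cancel only if they are mutually inverse.\<close>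

lemma not_revisits_short:
  "legal_move [] s \<Longrightarrow> \<not> revisits [s]"
  "legal_move [] s \<Longrightarrow> legal_move [s] t \<Longrightarrow> \<not> revisits [s, t]"
proof -
  have sd: "\<not> int m dvd 2" "\<not> int n dvd 2" "m \<noteq> Suc 0" "n \<noteq> Suc 0"
    using small_not_dvd[of 2] n3 m3 by auto
  show "\<not> revisits [s]" if "legal_move [] s"
    using legal_move_letters[OF that] sd
    by (auto simp: revisits_iff short_words one_eq_pt pt_eq_iff)
  show "\<not> revisits [s, t]" if "legal_move [] s" "legal_move [s] t"
  proof -
    have "t \<noteq> inv\<^bsub>G\<^esub> s" using that(2) by (simp add: legal_move_def)
    then show ?thesis
      using legal_move_letters[OF that(1)] legal_move_letters[OF that(2)] sd
      by (auto simp: revisits_iff short_words one_eq_pt pt_eq_iff)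
  qed
qed

lemma Player2_wins:
  assumes "int m dvd int n"
  shows "has_winning_strategy Player2"
proof -
  \<comment> \<open>The head of the play is the opponent's first letter; its sign is given to both
    \<open>\<alpha>\<close> and \<open>\<beta>\<close>.\<close>
  define \<sigma> where "\<sigma> ws = (if hd ws \<in> {pt 1 0, pt 0 1} then reply (pt 1 0) (pt 0 1) (last ws)
    else reply (pt (- 1) 0) (pt 0 (- 1)) (last ws))" for ws
  have "winning_strategy Player2 \<sigma>"
  proof (rule winning_strategy_by_replies[where L = 2])
    fix ws assume ws: "play ws" "follows Player2 \<sigma> ws" "length ws < 2" "to_move ws = Player2"
    then obtain s where s: "ws = [s]" by (cases ws) (auto simp: to_move_def)
    have l: "legal_move [] s" using ws(1) by (simp add: s short_plays)
    have "\<sigma> [s] \<in> letters \<and> \<sigma> [s] \<noteq> inv\<^bsub>G\<^esub> s"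
      using legal_move_letters[OF l] by (auto simp: \<sigma>_def letters_eq_pt reply_def)
    then show "legal_move ws (\<sigma> ws)"
      using not_revisits_short(1)[OF l] by (simp add: s legal_move_def)
  next
    fix ws assume ws: "play ws" "follows Player2 \<sigma> ws" "length ws = 2"
    then obtain s t where s: "ws = [s, t]" by (auto simp: numeral_2_eq_2 length_Suc_conv)
    have l: "legal_move [] s" using ws(1) by (simp add: s short_plays)
    have t: "t = \<sigma> [s]" using ws(2) follows_short(1) by (simp add: s)
    have base: "base 0 0 n v" for v using assms by (simp add: base_def)
    have *: "settled \<sigma> ws"
      if "(u, v) \<in> {(1, 0), (0, 1)}" "\<epsilon> \<in> {1, - 1}" "s = pt (\<epsilon> * u) (\<epsilon> * v)" for u v \<epsilon>
    proof -
      have "t = pt (\<epsilon> * v) (\<epsilon> * u)"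
        using that by (auto simp: t \<sigma>_def reply_def)
      moreover have "\<sigma> ([] @ [s, t] @ w) = reply (pt \<epsilon> 0) (pt 0 \<epsilon>) (last (t # w))" for w
        using that by (auto simp: \<sigma>_def)
      ultimately have "settled \<sigma> ([] @ [s, t])"
        by (intro settled_start[OF base that(1,2,2) _ _ that(3)]) (auto simp: one_eq_pt)
      then show ?thesis by (simp add: s)
    qed
    have "s \<in> {pt 1 0, pt 0 1, pt (- 1) 0, pt 0 (- 1)}" by (rule legal_move_letters[OF l])
    then have "settled \<sigma> ws"
      using *[of 1 0 1] *[of 0 1 1] *[of 1 0 "- 1"] *[of 0 1 "- 1"] by auto
    then show "to_move ws \<noteq> Player2 \<and> settled \<sigma> ws"
      by (simp add: to_move_def s)
  qed
  then show ?thesis by (auto simp: has_winning_strategy_def)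
qed

text \<open>The inspected opening has three letters: \<open>s\<close> leads to \<open>c 0\<close>,
  \<open>t\<close> is the opponent's step, and the answer closes the first square or revisits at
  once.\<close>

lemma Player1_winsI:
  assumes s: "s \<in> letters" "\<sigma> [] = s"
    and \<sigma>: "\<And>t. t \<in> {pt 1 0, pt 0 1, pt (- 1) 0, pt 0 (- 1)} \<Longrightarrow> t \<noteq> inv\<^bsub>G\<^esub> s \<Longrightarrow>
      \<sigma> [s, t] \<in> letters \<and> \<sigma> [s, t] \<noteq> inv\<^bsub>G\<^esub> t \<and> settled \<sigma> [s, t, \<sigma> [s, t]]"
  shows "has_winning_strategy Player1"
proof -
  have legal: "t \<in> {pt 1 0, pt 0 1, pt (- 1) 0, pt 0 (- 1)}" "t \<noteq> inv\<^bsub>G\<^esub> s"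
    if "legal_move [s] t" for t
    using legal_move_letters[OF that] that by (simp_all add: legal_move_def)
  have "winning_strategy Player1 \<sigma>"
  proof (rule winning_strategy_by_replies[where L = 3])
    fix ws assume ws: "play ws" "follows Player1 \<sigma> ws" "length ws < 3" "to_move ws = Player1"
    then consider "ws = []" | s' t where "ws = [s', t]"
      by (cases ws rule: remdups_adj.cases) (auto simp: to_move_def)
    then show "legal_move ws (\<sigma> ws)"
    proof cases
      case 1
      then show ?thesis using s by (simp add: legal_move_def revisits_def)
    next
      case (2 s' t)
      have s': "s' = s" using ws(2) s(2) follows_short(2)[of \<sigma> s' t] by (simp add: 2)
      have l: "legal_move [] s" "legal_move [s] t"
        using ws(1) by (simp_all add: 2 s' short_plays)
      show ?thesis
        using not_revisits_short(2)[OF l] \<sigma>[OF legal[OF l(2)]] by (simp add: 2 s' legal_move_def)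
    qed
  next
    fix ws assume ws: "play ws" "follows Player1 \<sigma> ws" "length ws = 3"
    then obtain s' t r where 2: "ws = [s', t, r]" by (auto simp: numeral_3_eq_3 length_Suc_conv)
    have s': "s' = s" "r = \<sigma> [s, t]" using ws(2) s(2) follows_short(3)[of \<sigma> s' t r] by (auto simp: 2)
    have "legal_move [s] t"
      using ws(1) by (simp add: 2 s' short_plays)
    then show "to_move ws \<noteq> Player1 \<and> settled \<sigma> ws"
      using \<sigma>[OF legal] by (simp add: 2 s' to_move_def)
  qed
  then show ?thesis by (auto simp: has_winning_strategy_def)
qed

lemma Player1_wins_dvd_minus_1:
  assumes "int m dvd int n - 1"
  shows "has_winning_strategy Player1"
proof -
  \<comment> \<open>The opening letter fixes the sign of \<open>\<alpha>\<close>; the opponent's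
    first letter \<open>ws ! 1\<close> decides that of \<open>\<beta>\<close>.\<close>
  define \<sigma> where "\<sigma> ws = (if ws = [] then pt 1 0
    else reply (pt 1 0) (if ws ! 1 = pt 0 (- 1) then pt 0 (- 1) else pt 0 1) (last ws))" for ws
  have base: "base 1 0 (n - 1) v" for v using assms by (simp add: base_def)
  show ?thesis
  proof (rule Player1_winsI[of "pt 1 0" \<sigma>])
    fix t assume t: "t \<in> {pt 1 0, pt 0 1, pt (- 1) 0, pt 0 (- 1)}" "t \<noteq> inv\<^bsub>G\<^esub> pt 1 0"
    let ?r = "\<sigma> [pt 1 0, t]"
    have *: "settled \<sigma> [pt 1 0, t, ?r]"
      if "(u, v) \<in> {(1, 0), (0, 1)}" "\<delta> \<in> {1, - 1}" "t = pt (1 * u) (\<delta> * v)"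
        "?r = pt (1 * v) (\<delta> * u)" 
        "\<And>w. \<sigma> (pt 1 0 # t # ?r # w) = reply (pt 1 0) (pt 0 \<delta>) (last (?r # w))" for u v \<delta>
    proof -
      have "settled \<sigma> ([pt 1 0] @ [t, ?r])"
        by (rule settled_start[OF base that(1) _ that(2) _ _ that(3,4)])
           (use that(5) in \<open>auto simp: short_words one_eq_pt\<close>)
      then show ?thesis by simp
    qed
    have "t \<in> {pt 1 0, pt 0 1, pt 0 (- 1)}" using t by auto
    then show "?r \<in> letters \<and> ?r \<noteq> inv\<^bsub>G\<^esub> t \<and> settled \<sigma> [pt 1 0, t, ?r]"
      using *[of 1 0 1] *[of 0 1 1] *[of 0 1 "- 1"]
      by (auto simp: \<sigma>_def reply_def letters_eq_pt)
  qed (auto simp: \<sigma>_def letters_eq_pt)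
qed

lemma Player1_wins_dvd_plus_1:
  assumes "int m dvd int n + 1"
  shows "has_winning_strategy Player1"
proof -
  \<comment> \<open>Now the sign of \<open>\<beta>\<close> is fixed and \<open>ws ! 1\<close>
    decides that of \<open>\<alpha>\<close>. The exception for \<open>m = 3\<close> completes
    \<open>pt 0 3\<close>, the identity.\<close>
  define \<sigma> where "\<sigma> ws = (if ws = [] then pt 0 1 else if m = 3 \<and> ws = [pt 0 1, pt 0 1] then pt 0 1
    else reply (if ws ! 1 = pt (- 1) 0 then pt (- 1) 0 else pt 1 0) (pt 0 1) (last ws))" for ws
  have base: "base 0 1 n v" if "\<not> (m = 3 \<and> v = 1)" for v using assms that by (simp add: base_def)
  show ?thesis
  proof (rule Player1_winsI[of "pt 0 1" \<sigma>])
    fix t assume t: "t \<in> {pt 1 0, pt 0 1, pt (- 1) 0, pt 0 (- 1)}" "t \<noteq> inv\<^bsub>G\<^esub> pt 0 1"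
    let ?r = "\<sigma> [pt 0 1, t]"
    have *: "settled \<sigma> [pt 0 1, t, ?r]"
      if "(u, v) \<in> {(1, 0), (0, 1)}" "\<epsilon> \<in> {1, - 1}" "t = pt (\<epsilon> * u) (1 * v)"
        "?r = pt (\<epsilon> * v) (1 * u)" "\<And>w. \<sigma> (pt 0 1 # t # ?r # w) = reply (pt \<epsilon> 0) (pt 0 1) (last (?r # w))"
        "\<not> (m = 3 \<and> v = 1)" for u v \<epsilon>
    proof -
      have "settled \<sigma> ([pt 0 1] @ [t, ?r])"
        by (rule settled_start[OF base[OF that(6)] that(1,2) _ _ _ that(3,4)])
           (use that(5) in \<open>auto simp: short_words one_eq_pt\<close>)
      then show ?thesis by simp
    qed
    \<comment> \<open>The third letter returns to the empty word's value, so no staircase is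
      involved.\<close>
    have three: "settled \<sigma> [pt 0 1, pt 0 1, pt 0 1]" if "m = 3"
    proof -
      have "pt 0 3 = pt 0 0" unfolding pt_def by (simp add: that)
      then show ?thesis
        by (simp add: settled_def revisits_iff short_words one_eq_pt)
    qed
    have t': "t \<in> {pt 1 0, pt 0 1, pt (- 1) 0}" using t by auto
    show "?r \<in> letters \<and> ?r \<noteq> inv\<^bsub>G\<^esub> t \<and> settled \<sigma> [pt 0 1, t, ?r]"
    proof (cases "m = 3 \<and> t = pt 0 1")
      case True
      then have "t = pt 0 1" "?r = pt 0 1" by (auto simp: \<sigma>_def)
      moreover have "pt 0 1 \<in> letters" "pt 0 1 \<noteq> inv\<^bsub>G\<^esub> pt 0 1" by (simp_all add: letters_eq_pt)
      ultimately show ?thesis using three True by metis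
    next
      case False
      then show ?thesis
        using *[of 1 0 1] *[of 0 1 1] *[of 1 0 "- 1"] t'
        by (auto simp: \<sigma>_def reply_def letters_eq_pt)
    qed
  qed (auto simp: \<sigma>_def letters_eq_pt)
qed

end

theorem theorem5p1:
  fixes n m :: nat
  assumes "n \<ge> 3" and "m \<ge> 3" and "n \<ge> m - 1"
  shows "([int n = 1] (mod int m) \<or> [int n = - 1] (mod int m)
            \<longrightarrow> rel_game.has_winning_strategy (Zmod_prod n m) {(1, 0), (0, 1)} Player1)
       \<and> ([int n = 0] (mod int m)
            \<longrightarrow> rel_game.has_winning_strategy (Zmod_prod n m) {(1, 0), (0, 1)} Player2)"
proof -
  interpret torus_game n m
    by unfold_locales (use assms in auto)
  show ?thesis
    using Player1_wins_dvd_minus_1 Player1_wins_dvd_plus_1 Player2_wins by (auto simp: cong_iff_dvd_diff)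
qed

end
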